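(* $\mathfrak{M}_L^U(\mathbb{R}^d)\subsetneqq\mathfrak{R}(\mathcal{A}_1)=\mathfrak{R}(\mathcal{A}_2)$, where $\mathfrak{R}(\mathcal{A}_k)=\{\mathcal{A}_k(\nu):\nu\in\mathfrak{M}_L^k(\mathbb{R}^d)\}$.
   Context: A Lévy measure on $\mathbb{R}^d$ is a measure $\nu$ with $\nu(\{0\})=0$ and $\int(1\wedge|x|^2)\nu(\mathrm{d}x)<\infty$; their class is $\mathfrak{M}_L(\mathbb{R}^d)=\mathfrak{M}_L^2(\mathbb{R}^d)$, and $\mathfrak{M}_L^1(\mathbb{R}^d)$ is the class of Lévy measures with $\int(1\wedge|x|)\nu(\mathrm{d}x)<\infty$. For $s>0$ set $a_1(r;s)=2\pi^{-1}(s-r^2)^{-1/2}$ for $0<r<s^{1/2}$ and $0$ otherwise; $a_2(r;s)=2\pi^{-1}(s^2-r^2)^{-1/2}$ for $0<r<s$ and $0$ otherwise. $\mathcal{A}_k(\nu)(B)=\int_{\mathbb{R}^d\setminus\{0\}}\nu(\mathrm{d}x)\int_0^\infty a_k(r;|x|)1_B(rx/|x|)\,\mathrm{d}r$. A polar decomposition of $\nu\in\mathfrak{M}_L(\mathbb{R}^d)$ is a pair $(\lambda,\{\nu_\xi\})$, $\lambda$ a measure on the unit sphere $\mathbb{S}$, $\nu_\xi$ measures on $(0,\infty)$ with $\nu_\xi(E)$ measurable in $\xi$, $0<\nu_\xi((0,\infty))\le\infty$, and $\nu(B)=\int_{\mathbb{S}}\lambda(\mathrm{d}\xi)\int_0^\infty1_B(r\xi)\nu_\xi(\mathrm{d}r)$.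 $\mathfrak{M}_L^U(\mathbb{R}^d)$ (Lévy measures of the Jurek class) is the class of $\nu\in\mathfrak{M}_L(\mathbb{R}^d)$ having a polar decomposition with $\nu_\xi(\mathrm{d}r)=\ell_\xi(r)\mathrm{d}r$, where $\ell_\xi(r)$ is measurable in $(\xi,r)$ and nonincreasing and right-continuous in $r>0$. *)

theory Defs
  imports "HOL-Analysis.Analysis"
begin

definition levy_measure :: "'a::euclidean_space measure \<Rightarrow> bool" where
  "levy_measure \<nu> \<longleftrightarrow> sets \<nu> = sets borel \<and> emeasure \<nu> {0} = 0 \<and>
     (\<integral>\<^sup>+x. ennreal (min 1 (norm x ^ 2)) \<partial>\<nu>) < \<infinity>"

definition levy_measure1 :: "'a::euclidean_space measure \<Rightarrow> bool" where
  "levy_measure1 \<nu> \<longleftrightarrow> levy_measure \<nu> \<and>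
     (\<integral>\<^sup>+x. ennreal (min 1 (norm x)) \<partial>\<nu>) < \<infinity>"

definition levy_class :: "nat \<Rightarrow> 'a::euclidean_space measure set" where
  "levy_class k = (if k = 1 then {\<nu>. levy_measure1 \<nu>} else {\<nu>. levy_measure \<nu>})"

definition a1 :: "real \<Rightarrow> real \<Rightarrow> real" where
  "a1 r s = (if 0 < r \<and> r < sqrt s then 2 / pi * (s - r\<^sup>2) powr (-1/2) else 0)"

definition a2 :: "real \<Rightarrow> real \<Rightarrow> real" where
  "a2 r s = (if 0 < r \<and> r < s then 2 / pi * (s\<^sup>2 - r\<^sup>2) powr (-1/2) else 0)"

definition akern :: "nat \<Rightarrow> real \<Rightarrow> real \<Rightarrow> real" where
  "akern k = (if k = 1 then a1 else a2)"

definition A_op :: "nat \<Rightarrow> 'a::euclidean_space measure \<Rightarrow> 'a measure" where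
  "A_op k \<nu> = measure_of UNIV (sets borel)
     (\<lambda>B. \<integral>\<^sup>+x\<in>(- {0}). (\<integral>\<^sup>+r\<in>{0<..}. ennreal (akern k r (norm x)) * indicator B (r *\<^sub>R (x /\<^sub>R norm x)) \<partial>lborel) \<partial>\<nu>)"

definition A_range :: "nat \<Rightarrow> 'a::euclidean_space measure set" where
  "A_range k = A_op k ` levy_class k"

text \<open>Jurek class M_L^U: Levy measures with a polar decomposition (lambda, nu_xi) where
  lambda is a measure on the unit sphere (represented as a Borel measure on R^d
  concentrated on the sphere) and nu_xi(dr) = l_xi(r) dr with l jointly measurable,
  nonincreasing and right-continuous in r > 0, and 0 < nu_xi((0,infty)).\<close>
definition jurek_levy_class :: "'a::euclidean_space measure set" where
  "jurek_levy_class = {\<nu>. levy_measure \<nu> \<and>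
     (\<exists>(lam::'a measure) (ell::'a \<Rightarrow> real \<Rightarrow> real).
        sets lam = sets borel \<and> emeasure lam (- sphere 0 1) = 0 \<and>
        (\<lambda>(\<xi>, r). ell \<xi> r) \<in> borel_measurable (borel \<Otimes>\<^sub>M borel) \<and>
        (\<forall>\<xi>\<in>sphere 0 1. \<forall>r>0. 0 \<le> ell \<xi> r) \<and>
        (\<forall>\<xi>\<in>sphere 0 1. \<forall>r s. 0 < r \<longrightarrow> r \<le> s \<longrightarrow> ell \<xi> s \<le> ell \<xi> r) \<and>
        (\<forall>\<xi>\<in>sphere 0 1. \<forall>r>0. continuous (at_right r) (ell \<xi>)) \<and>
        (\<forall>\<xi>\<in>sphere 0 1. 0 < (\<integral>\<^sup>+r\<in>{0<..}. ennreal (ell \<xi> r) \<partial>lborel)) \<and>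
        (\<forall>B\<in>sets borel. emeasure \<nu> B =
           (\<integral>\<^sup>+\<xi>\<in>sphere 0 1. (\<integral>\<^sup>+r\<in>{0<..}. ennreal (ell \<xi> r) * indicator B (r *\<^sub>R \<xi>) \<partial>lborel) \<partial>lam)))}"

end

theory Submission
  imports Defs
begin

text \<open>
  Since \<open>a\<^sub>1(r; s) = a\<^sub>2(r; \<surd>s)\<close>, pushing \<open>\<nu>\<close> forward along \<open>x \<mapsto> x / \<surd>\<bar>x\<bar>\<close> or its inverse
  \<open>x \<mapsto> \<bar>x\<bar> x\<close> translates between the two operators, and the integrability conditions correspond.

  For the inclusion, Abel's identity \<open>\<integral>\<^sub>r\<^sup>t a\<^sub>2(r; s) s (t\<^sup>2 - s\<^sup>2)\<^sup>-\<^sup>1\<^sup>/\<^sup>2 ds = 1\<close> represents the uniform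
  density on \<open>(0, t)\<close> as a mixture of arcsine densities. A nonincreasing right-continuous \<open>\<ell>\<close> vanishing at
  infinity is a mixture of uniform densities by the layer-cake formula
  \<open>\<ell>(r) = \<integral>\<^sub>0\<^sup>\<infinity> 1{r < g(y)} dy\<close>, where \<open>g\<close> is the generalized inverse of \<open>\<ell>\<close>, so Tonelli's theorem
  yields a preimage of any measure in the Jurek class. The preimage is a Levy measure because
  \<open>\<integral> (1 \<and> r\<^sup>2) a\<^sub>2(r; s) dr\<close> is at least a constant times \<open>1 \<and> s\<^sup>2\<close>.

  The inclusion is strict because the image of a point mass has a strictly increasing radial density on
  \<open>(0, 1)\<close>.
\<close>

section \<open>The operators as push-forwards of product measures\<close>

lemma measurable_akern [measurable (raw)]:
  assumes [measurable]: "f \<in> borel_measurable M" "g \<in> borel_measurable M"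
  shows "(\<lambda>x. akern k (f x) (g x)) \<in> borel_measurable M"
  unfolding akern_def a1_def a2_def by (cases "k = 1") simp_all

text \<open>Images under \<open>A_op\<close> and measures with a polar decomposition both have this
  shape: a base measure, a radial density and a map into the space. One integration formula then
  serves for both.\<close>

definition push :: "'b measure \<Rightarrow> ('b \<times> real \<Rightarrow> ennreal) \<Rightarrow> ('b \<times> real \<Rightarrow> 'a) \<Rightarrow> 'a::euclidean_space measure" where
  "push M f h = distr (density (M \<Otimes>\<^sub>M lborel) f) borel h"

lemma sets_push [simp, measurable_cong]: "sets (push M f h) = sets borel"
  by (simp add: push_def)

text \<open>Integrating first over the Lebesgue factor requires sigma-finiteness of
  \<open>lborel\<close> only, so \<open>M\<close> may be an arbitrary Levy or spherical
  measure.\<close>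

lemma nn_integral_push:
  assumes [measurable]: "f \<in> borel_measurable (M \<Otimes>\<^sub>M borel)" "h \<in> borel_measurable (M \<Otimes>\<^sub>M borel)"
    "F \<in> borel_measurable borel"
  shows "(\<integral>\<^sup>+z. F z \<partial>push M f h) = (\<integral>\<^sup>+x. \<integral>\<^sup>+r. f (x, r) * F (h (x, r)) \<partial>lborel \<partial>M)"
proof -
  have "(\<integral>\<^sup>+z. F z \<partial>push M f h) = (\<integral>\<^sup>+p. f p * F (h p) \<partial>(M \<Otimes>\<^sub>M lborel))"
    unfolding push_def
    by (subst nn_integral_distr) (auto simp: nn_integral_density)
  also have "\<dots> = (\<integral>\<^sup>+x. \<integral>\<^sup>+r. f (x, r) * F (h (x, r)) \<partial>lborel \<partial>M)"
    by (rule lborel.nn_integral_fst[symmetric]) measurable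
  finally show ?thesis .
qed

lemma emeasure_push:
  assumes [measurable]: "f \<in> borel_measurable (M \<Otimes>\<^sub>M borel)" "h \<in> borel_measurable (M \<Otimes>\<^sub>M borel)"
    "B \<in> sets borel"
  shows "emeasure (push M f h) B = (\<integral>\<^sup>+x. \<integral>\<^sup>+r. f (x, r) * indicator B (h (x, r)) \<partial>lborel \<partial>M)"
  using nn_integral_push[of f M h "indicator B"] by simp

text \<open>\<open>measure_of\<close> returns the prescribed values only if the set function is
  countably additive. Recognizing these values as those of a \<open>push\<close> settles this and
  gives access to the integration formula.\<close>

lemma A_op_eq_push:
  fixes \<nu> :: "'a::euclidean_space measure"
  assumes [measurable_cong]: "sets \<nu> = sets borel"
  shows "A_op k \<nu> = push \<nu> (\<lambda>(x, r). ennreal (akern k r (norm x)) * indicator (-{0}) x * indicator {0<..} r)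
           (\<lambda>(x, r). r *\<^sub>R (x /\<^sub>R norm x))" (is "_ = ?N")
proof -
  have "A_op k \<nu> = measure_of UNIV (sets borel) (emeasure ?N)"
    unfolding A_op_def
  proof (rule measure_of_eq)
    show "sets (borel::'a measure) \<subseteq> Pow UNIV" by simp
  next
    fix B :: "'a set" assume "B \<in> sigma_sets UNIV (sets borel)"
    then have [measurable]: "B \<in> sets borel"
      using sets.sigma_sets_eq[of "borel :: 'a measure"] by simp
    show "(\<integral>\<^sup>+x\<in>(- {0}). (\<integral>\<^sup>+r\<in>{0<..}. ennreal (akern k r (norm x)) * indicator B (r *\<^sub>R (x /\<^sub>R norm x)) \<partial>lborel) \<partial>\<nu>)
      = emeasure ?N B"
      by (subst emeasure_push)
        (auto intro!: nn_integral_cong simp: indicator_def)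
  qed
  also have "\<dots> = measure_of (space ?N) (sets ?N) (emeasure ?N)"
    by (simp add: push_def)
  also have "\<dots> = ?N" by (rule measure_of_of_measure)
  finally show ?thesis .
qed

lemma sets_A_op [simp, measurable_cong]: "sets (A_op k \<nu>) = sets borel"
  unfolding A_op_def using sets.sigma_sets_eq[of "borel :: 'a measure"]
  by (simp add: sets_measure_of_conv)

lemma nn_integral_A_op:
  fixes \<nu> :: "'a::euclidean_space measure"
  assumes [measurable_cong]: "sets \<nu> = sets borel"
    and [measurable]: "F \<in> borel_measurable borel"
  shows "(\<integral>\<^sup>+z. F z \<partial>A_op k \<nu>) =
    (\<integral>\<^sup>+x\<in>- {0}. (\<integral>\<^sup>+r\<in>{0<..}. ennreal (akern k r (norm x)) * F (r *\<^sub>R (x /\<^sub>R norm x)) \<partial>lborel) \<partial>\<nu>)"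
  unfolding A_op_eq_push[OF assms(1)]
  by (subst nn_integral_push) (auto intro!: nn_integral_cong simp: indicator_def)

lemma emeasure_A_op:
  fixes \<nu> :: "'a::euclidean_space measure"
  assumes "sets \<nu> = sets borel" "B \<in> sets borel"
  shows "emeasure (A_op k \<nu>) B =
    (\<integral>\<^sup>+x\<in>- {0}. (\<integral>\<^sup>+r\<in>{0<..}. ennreal (akern k r (norm x)) * indicator B (r *\<^sub>R (x /\<^sub>R norm x)) \<partial>lborel) \<partial>\<nu>)"
  using nn_integral_A_op[of \<nu> "indicator B" k] assms by simp

section \<open>Equality of the two ranges by a radial change of variables\<close>

lemma a1_eq_a2: "0 \<le> s \<Longrightarrow> a1 r s = a2 r (sqrt s)"
  by (simp add: a1_def a2_def)

text \<open>The integrand of \<open>A_op\<close> sees a point only through its direction and through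
  the kernel at its norm. A map that keeps directions and turns one kernel into the other therefore
  leaves the result unchanged.\<close>

lemma A_op_distr:
  fixes \<nu> :: "'a::euclidean_space measure"
  assumes s[measurable_cong]: "sets \<nu> = sets borel"
    and [measurable]: "\<phi> \<in> borel_measurable borel"
    and z: "\<And>x. \<phi> x = 0 \<longleftrightarrow> x = 0"
    and dir: "\<And>x. \<phi> x /\<^sub>R norm (\<phi> x) = x /\<^sub>R norm x"
    and ker: "\<And>r x. akern k r (norm (\<phi> x)) = akern j r (norm x)"
  shows "A_op k (distr \<nu> borel \<phi>) = A_op j \<nu>"
proof (rule measure_eqI)
  have dir': "(c * inverse (norm (\<phi> x))) *\<^sub>R \<phi> x = (c * inverse (norm x)) *\<^sub>R x" for c x
    by (metis dir scaleR_scaleR)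
  fix B assume "B \<in> sets (A_op k (distr \<nu> borel \<phi>))"
  then have [measurable]: "B \<in> sets borel" by simp
  show "emeasure (A_op k (distr \<nu> borel \<phi>)) B = emeasure (A_op j \<nu>) B"
    using s by (simp add: emeasure_A_op nn_integral_distr ker dir' z indicator_def)
qed simp

lemma levy_distr:
  fixes \<nu> :: "'a::euclidean_space measure"
  assumes s[measurable_cong]: "sets \<nu> = sets borel"
    and n: "emeasure \<nu> {0} = 0"
    and [measurable]: "\<phi> \<in> borel_measurable borel"
    and z: "\<And>x. \<phi> x = 0 \<longleftrightarrow> x = 0"
    and fin: "(\<integral>\<^sup>+x. ennreal (min 1 (norm (\<phi> x) ^ 2)) \<partial>\<nu>) < \<infinity>"
  shows "levy_measure (distr \<nu> borel \<phi>)"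
proof -
  have "\<phi> -` {0} \<inter> space \<nu> = {0}" 
    using z sets_eq_imp_space_eq[OF s] by auto
  then show ?thesis
    unfolding levy_measure_def using n fin by (simp add: emeasure_distr nn_integral_distr)
qed

lemma A_range_1_eq_2: "A_range 1 = (A_range 2 :: 'a::euclidean_space measure set)"
proof
  show "A_range 1 \<subseteq> (A_range 2 :: 'a measure set)"
  proof
    fix \<mu> :: "'a measure" assume "\<mu> \<in> A_range 1"
    then obtain \<nu> where \<mu>: "\<mu> = A_op 1 \<nu>" and l: "levy_measure1 \<nu>"
      by (auto simp: A_range_def levy_class_def)
    \<comment> \<open>Norms become square roots, so the condition on
      \<open>min 1 (norm x ^ 2)\<close> for the image is exactly the one on
      \<open>min 1 (norm x)\<close> for \<open>\<nu>\<close>. At the origin the division yields 0,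
      as required.\<close>
    define \<phi> where "\<phi> x = x /\<^sub>R sqrt (norm x)" for x :: 'a
    have [measurable]: "\<phi> \<in> borel_measurable borel" unfolding \<phi>_def by measurable
    have nrm: "norm (\<phi> x) = sqrt (norm x)" for x
      by (simp add: \<phi>_def divide_inverse[symmetric] real_div_sqrt abs_of_nonneg mult.commute)
    have z: "\<phi> x = 0 \<longleftrightarrow> x = 0" for x by (simp add: \<phi>_def)
    have "A_op 2 (distr \<nu> borel \<phi>) = A_op 1 \<nu>"
    proof (rule A_op_distr)
      show "\<phi> x /\<^sub>R norm (\<phi> x) = x /\<^sub>R norm x" for x
        unfolding nrm by (simp add: \<phi>_def flip: inverse_mult_distrib)
      show "akern 2 r (norm (\<phi> x)) = akern 1 r (norm x)" for r x
        by (simp add: akern_def a1_eq_a2 nrm)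
    qed (use l z in \<open>auto simp: levy_measure1_def levy_measure_def\<close>)
    moreover have "levy_measure (distr \<nu> borel \<phi>)"
      by (rule levy_distr) (use l z in \<open>auto simp: levy_measure1_def levy_measure_def nrm\<close>)
    ultimately show "\<mu> \<in> A_range 2"
      by (auto simp: A_range_def levy_class_def \<mu> intro!: image_eqI[where x="distr \<nu> borel \<phi>"])
  qed
  show "A_range 2 \<subseteq> (A_range 1 :: 'a measure set)"
  proof
    fix \<mu> :: "'a measure" assume "\<mu> \<in> A_range 2"
    then obtain \<nu> where \<mu>: "\<mu> = A_op 2 \<nu>" and l: "levy_measure \<nu>"
      by (auto simp: A_range_def levy_class_def)
    then have s[measurable_cong]: "sets \<nu> = sets borel" by (simp add: levy_measure_def)
    \<comment> \<open>The inverse of the previous map: norms are squared, and the condition on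
      \<open>min 1 (norm x)\<close> for the image is the Levy condition for
      \<open>\<nu>\<close>.\<close>
    define \<phi> where "\<phi> x = norm x *\<^sub>R x" for x :: 'a
    have [measurable]: "\<phi> \<in> borel_measurable borel" unfolding \<phi>_def by measurable
    have nrm: "norm (\<phi> x) = (norm x)\<^sup>2" for x
      by (simp add: \<phi>_def power2_eq_square)
    have z: "\<phi> x = 0 \<longleftrightarrow> x = 0" for x by (simp add: \<phi>_def)
    have "A_op 1 (distr \<nu> borel \<phi>) = A_op 2 \<nu>"
    proof (rule A_op_distr)
      show "\<phi> x /\<^sub>R norm (\<phi> x) = x /\<^sub>R norm x" for x
        unfolding nrm by (cases "x = 0") (simp_all add: \<phi>_def power2_eq_square)
      show "akern 1 r (norm (\<phi> x)) = akern 2 r (norm x)" for r x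
        by (simp add: akern_def a1_eq_a2 nrm)
    qed (use s z in auto)
    moreover have "levy_measure1 (distr \<nu> borel \<phi>)"
    proof -
      \<comment> \<open>The image must also be a Levy measure; its integrand is now of fourth order
        in the norm and hence smaller.\<close>
      have "(\<integral>\<^sup>+x. ennreal (min 1 (norm (\<phi> x) ^ 2)) \<partial>\<nu>) \<le> (\<integral>\<^sup>+x. ennreal (min 1 (norm x ^ 2)) \<partial>\<nu>)"
      proof (intro nn_integral_mono ennreal_leI)
        fix x :: 'a
        have "((norm x)\<^sup>2)\<^sup>2 \<le> (norm x)\<^sup>2" if "(norm x)\<^sup>2 \<le> 1"
          using that mult_left_le[of "(norm x)\<^sup>2" "(norm x)\<^sup>2"] by (simp add: power2_eq_square)
        then show "min 1 (norm (\<phi> x) ^ 2) \<le> min 1 (norm x ^ 2)"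
          by (cases "(norm x)\<^sup>2 \<le> 1") (auto simp: nrm min_def)
      qed
      also have "\<dots> < \<infinity>" using l by (simp add: levy_measure_def)
      finally have "levy_measure (distr \<nu> borel \<phi>)"
        using l z s by (intro levy_distr) (auto simp: levy_measure_def)
      then show ?thesis
        using l by (simp add: levy_measure1_def nn_integral_distr nrm levy_measure_def)
    qed
    ultimately show "\<mu> \<in> A_range 1"
      by (auto simp: A_range_def levy_class_def \<mu> intro!: image_eqI[where x="distr \<nu> borel \<phi>"])
  qed
qed

section \<open>Bounds for the arcsine density and the Levy property of preimages\<close>

lemma a2_strict_mono:
  assumes "0 < r" "r < r'" "r' < s"
  shows "a2 r s < a2 r' s"
proof -
  have "r\<^sup>2 < r'\<^sup>2" "r'\<^sup>2 < s\<^sup>2" using assms by (auto intro: power_strict_mono)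
  then have "(s\<^sup>2 - r\<^sup>2) powr (-1/2) < (s\<^sup>2 - r'\<^sup>2) powr (-1/2)"
    by (intro powr_less_mono2_neg) auto
  then show ?thesis using assms by (auto simp: a2_def intro: divide_strict_right_mono)
qed

lemma a2_mono: "0 < r \<Longrightarrow> r \<le> r' \<Longrightarrow> r' < s \<Longrightarrow> a2 r s \<le> a2 r' s"
  using a2_strict_mono[of r r' s] by (cases "r = r'") auto

lemma a2_ge:
  assumes "0 < r" "r < s"
  shows "2 / (pi * s) \<le> a2 r s"
proof -
  have "r\<^sup>2 < s\<^sup>2" using assms by (auto intro: power_strict_mono)
  then have "(s\<^sup>2) powr (-1/2) \<le> (s\<^sup>2 - r\<^sup>2) powr (-1/2)"
    by (intro powr_mono2') (use assms in auto)
  moreover have "(s\<^sup>2) powr (-1/2) = 1 / s"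
    using assms by (simp add: powr_minus_divide powr_half_sqrt)
  ultimately have "1 / s \<le> (s\<^sup>2 - r\<^sup>2) powr (-1/2)" by simp
  from mult_left_mono[OF this, of "2 / pi"] show ?thesis using assms by (simp add: a2_def)
qed

text \<open>By \<open>a2_ge\<close> the arcsine law of scale \<open>s\<close> gives
  \<open>(s/2, s)\<close> mass at least \<open>1/pi\<close>, and there \<open>min 1 (r^2)\<close> is
  at least a quarter of \<open>min 1 (s^2)\<close>. The resulting constant \<open>1/(4*pi)\<close>
  bounds the integral for \<open>\<eta>\<close> by the one for its image.\<close>

lemma levy_measure_if_A_op:
  fixes \<eta> :: "'a::euclidean_space measure"
  assumes s[measurable_cong]: "sets \<eta> = sets borel" and z: "emeasure \<eta> {0} = 0"
    and l: "levy_measure (A_op 2 \<eta>)"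
  shows "levy_measure \<eta>"
proof -
  have low: "ennreal (1 / (4 * pi)) * ennreal (min 1 (norm x ^ 2)) \<le>
     (\<integral>\<^sup>+r\<in>{0<..}. ennreal (akern 2 r (norm x)) * ennreal (min 1 (norm (r *\<^sub>R (x /\<^sub>R norm x)) ^ 2)) \<partial>lborel)"
    if "x \<noteq> 0" for x :: 'a
  proof -
    define s where "s = norm x"
    have s: "s > 0" using that by (simp add: s_def)
    have "ennreal (1 / (4 * pi)) * ennreal (min 1 (s ^ 2)) =
       (\<integral>\<^sup>+r. ennreal (2 / (pi * s) * (min 1 (s ^ 2) / 4)) * indicator {s/2<..<s} r \<partial>lborel)"
      by (subst nn_integral_cmult_indicator) (use s in \<open>auto simp: field_simps simp flip: ennreal_mult\<close>)
    also have "\<dots> \<le> (\<integral>\<^sup>+r\<in>{0<..}. ennreal (akern 2 r s) * ennreal (min 1 (norm (r *\<^sub>R (x /\<^sub>R norm x)) ^ 2)) \<partial>lborel)"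
    proof (intro nn_integral_mono)
      fix r :: real
      have nr: "r * inverse (norm x) * norm x = r" using \<open>x \<noteq> 0\<close> by simp
      have "2 / (pi * s) * (min 1 (s ^ 2) / 4) \<le> a2 r s * min 1 (r\<^sup>2)" if r: "s/2 < r" "r < s"
      proof (rule mult_mono)
        have "(s/2)\<^sup>2 \<le> r\<^sup>2" by (rule power_mono) (use r s in auto)
        then show "min 1 (s\<^sup>2) / 4 \<le> min 1 (r\<^sup>2)" by (auto simp: min_def power_divide)
      qed (use a2_ge[of r s] r s in \<open>auto simp: a2_def\<close>)
      then show "ennreal (2 / (pi * s) * (min 1 (s ^ 2) / 4)) * indicator {s/2<..<s} r \<le> 
         ennreal (akern 2 r s) * ennreal (min 1 (norm (r *\<^sub>R (x /\<^sub>R norm x)) ^ 2)) * indicator {0<..} r"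
        using s \<open>x \<noteq> 0\<close> by (auto simp: nr indicator_def akern_def a2_def ennreal_mult[symmetric] intro!: ennreal_leI)
    qed
    finally show ?thesis by (simp add: s_def)
  qed
  have "ennreal (1 / (4 * pi)) * (\<integral>\<^sup>+x. ennreal (min 1 (norm x ^ 2)) \<partial>\<eta>) =
      (\<integral>\<^sup>+x. ennreal (1 / (4 * pi)) * ennreal (min 1 (norm x ^ 2)) \<partial>\<eta>)"
    by (rule nn_integral_cmult[symmetric]) measurable
  \<comment> \<open>At the origin the left integrand vanishes, so \<open>low\<close> is
    enough.\<close>
  also have "\<dots> \<le> (\<integral>\<^sup>+x. ennreal (min 1 (norm x ^ 2)) \<partial>A_op 2 \<eta>)"
    by (subst nn_integral_A_op[OF s])
       (use low in \<open>auto intro!: nn_integral_mono simp: indicator_def\<close>)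
  also have "\<dots> < \<infinity>" using l by (simp add: levy_measure_def)
  finally show ?thesis
    using s z by (auto simp: levy_measure_def ennreal_mult_less_top)
qed

section \<open>Abel's identity for the arcsine kernel\<close>

text \<open>For fixed \<open>t\<close> this is the mixing density over scales \<open>s\<close> that
  turns arcsine densities into the indicator of \<open>(0, t)\<close>.\<close>

definition abel_ker :: "real \<Rightarrow> real \<Rightarrow> real" where
  "abel_ker s t = (if 0 < s \<and> s < t then s * (t\<^sup>2 - s\<^sup>2) powr (-1/2) else 0)"

lemma measurable_a2 [measurable (raw)]:
  assumes [measurable]: "f \<in> borel_measurable M" "g \<in> borel_measurable M"
  shows "(\<lambda>x. a2 (f x) (g x)) \<in> borel_measurable M"
  unfolding a2_def by measurable

lemma measurable_abel_ker [measurable (raw)]: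
  assumes [measurable]: "f \<in> borel_measurable M" "g \<in> borel_measurable M"
  shows "(\<lambda>x. abel_ker (f x) (g x)) \<in> borel_measurable M"
  unfolding abel_ker_def by measurable

lemma a2_nonneg: "0 \<le> a2 r s"
  by (simp add: a2_def)

lemma abel_ker_nonneg: "0 \<le> abel_ker s t"
  by (simp add: abel_ker_def)

text \<open>Substituting \<open>u = s^2\<close> turns the integrand into the arcsine probability
  density on \<open>(r^2, t^2)\<close>. Accordingly \<open>w\<close> maps \<open>s^2\<close>
  affinely onto \<open>[-1, 1]\<close>, and \<open>arcsin (w s) / pi\<close> is an
  antiderivative.\<close>

lemma has_integral_a2_abel_ker:
  assumes r: "0 < r" and t: "r < t"
  shows "((\<lambda>s. a2 r s * abel_ker s t) has_integral 1) {r..t}"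
proof -
  define D where "D = t\<^sup>2 - r\<^sup>2"
  define w where "w s = (2 * s\<^sup>2 - r\<^sup>2 - t\<^sup>2) / D" for s
  define F where "F s = arcsin (w s) / pi" for s
  have D: "D > 0" using assms by (auto simp: D_def intro: power_strict_mono)
  have w_le: "-1 \<le> w s \<and> w s \<le> 1" if "r \<le> s" "s \<le> t" for s
  proof -
    have "r\<^sup>2 \<le> s\<^sup>2" "s\<^sup>2 \<le> t\<^sup>2" using that r by (auto intro: power_mono)
    then show ?thesis using D by (simp add: w_def field_simps D_def)
  qed
  have cont: "continuous_on {r..t} F"
    unfolding F_def
    by (intro continuous_on_divide continuous_on_arcsin continuous_intros)
       (use D w_le in \<open>auto simp: w_def intro!: continuous_intros\<close>)
  have der: "(F has_vector_derivative a2 r s * abel_ker s t) (at s)" if s: "s \<in> {r<..<t}" for s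
  proof -
    have lt: "r\<^sup>2 < s\<^sup>2" "s\<^sup>2 < t\<^sup>2" using s r by (auto intro: power_strict_mono)
    define P where "P = sqrt (s\<^sup>2 - r\<^sup>2)"
    define Q where "Q = sqrt (t\<^sup>2 - s\<^sup>2)"
    have PQ: "P > 0" "Q > 0" using lt by (auto simp: P_def Q_def)
    have w_lt: "-1 < w s" "w s < 1"
      using lt D by (simp_all add: w_def field_simps D_def)
    \<comment> \<open>The factors \<open>1 - w s\<close> and \<open>1 + w s\<close> are proportional
      to \<open>Q^2\<close> and \<open>P^2\<close>, so the derivative of \<open>arcsin\<close>
      supplies exactly the two square roots in the kernels.\<close>
    have "1 - (w s)\<^sup>2 = (2 * P * Q / D)\<^sup>2"
    proof -
      have "1 - (w s)\<^sup>2 = (1 - w s) * (1 + w s)" by (simp add: power2_eq_square algebra_simps)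
      also have "1 - w s = 2 * Q\<^sup>2 / D" using D lt by (simp add: w_def Q_def field_simps D_def)
      also have "1 + w s = 2 * P\<^sup>2 / D" using D lt by (simp add: w_def P_def field_simps D_def)
      finally show ?thesis by (simp add: power2_eq_square algebra_simps)
    qed
    then have sq: "sqrt (1 - (w s)\<^sup>2) = 2 * P * Q / D"
      using PQ D by (simp add: real_sqrt_unique)
    have "(w has_real_derivative 4 * s / D) (at s)"
      unfolding w_def using D by (auto intro!: derivative_eq_intros simp: power2_eq_square field_simps)
    then have "(F has_real_derivative (inverse (sqrt (1 - (w s)\<^sup>2)) * (4 * s / D)) / pi) (at s)"
      unfolding F_def by (intro DERIV_cdivide DERIV_chain2[OF DERIV_arcsin] w_lt)
    moreover have "(inverse (sqrt (1 - (w s)\<^sup>2)) * (4 * s / D)) / pi = a2 r s * abel_ker s t"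
    proof -
      have "a2 r s = 2 / (pi * P)" "abel_ker s t = s / Q"
        using s r lt by (simp_all add: a2_def abel_ker_def P_def Q_def powr_minus_divide powr_half_sqrt)
      with D PQ show ?thesis unfolding sq by simp
    qed
    ultimately show ?thesis by (simp add: has_real_derivative_iff_has_vector_derivative)
  qed
  \<comment> \<open>The integrand is unbounded near both endpoints, but \<open>F\<close> is
    continuous up to them, so differentiability inside the interval suffices.\<close>
  have "((\<lambda>s. a2 r s * abel_ker s t) has_integral F t - F r) {r..t}"
    by (rule fundamental_theorem_of_calculus_interior) (use t cont der in auto)
  moreover have "w t = 1" "w r = -1" using D by (auto simp: w_def D_def field_simps)
  ultimately show ?thesis by (simp add: F_def field_simps)
qed

text \<open>Every real \<open>t\<close> is covered, since later \<open>t\<close> is a generalized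
  inverse and may be 0; for \<open>t \<le> r\<close> no scale lies strictly between \<open>r\<close>
  and \<open>t\<close>.\<close>

lemma nn_integral_a2_abel_ker:
  assumes r: "0 < r"
  shows "(\<integral>\<^sup>+s. ennreal (a2 r s) * ennreal (abel_ker s t) \<partial>lborel) = indicator {r<..} t"
proof (cases "r < t")
  case True
  have "(\<integral>\<^sup>+s. ennreal (a2 r s) * ennreal (abel_ker s t) \<partial>lborel) =
     (\<integral>\<^sup>+s. ennreal (a2 r s * abel_ker s t) * indicator {r..t} s \<partial>lborel)"
    using r by (intro nn_integral_cong)
       (auto simp: ennreal_mult[symmetric] a2_nonneg abel_ker_nonneg indicator_def a2_def abel_ker_def)
  also have "\<dots> = ennreal 1"
    by (rule nn_integral_has_integral_lebesgue'[OF _ has_integral_a2_abel_ker])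
       (use r True in \<open>auto simp: a2_nonneg abel_ker_nonneg\<close>)
  finally show ?thesis using True by simp
next
  case False
  then have "(\<integral>\<^sup>+s. ennreal (a2 r s) * ennreal (abel_ker s t) \<partial>lborel) = (\<integral>\<^sup>+s. 0 \<partial>(lborel :: real measure))"
    by (intro nn_integral_cong) (auto simp: a2_def abel_ker_def)
  then show ?thesis using False by simp
qed

section \<open>Nonincreasing densities as mixtures of arcsine densities\<close>

text \<open>For a nonincreasing \<open>l\<close> this is the generalized inverse: the superlevel set is an interval
  starting at \<open>0\<close>. Defining it as an integral makes joint measurability in parameters immediate.\<close>
definition gen_inv :: "(real \<Rightarrow> real) \<Rightarrow> real \<Rightarrow> ennreal" where
  "gen_inv l y = (\<integral>\<^sup>+r. indicator {r. 0 < r \<and> y < l r} r \<partial>lborel)"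

text \<open>In the layer-cake formula each level \<open>y\<close> contributes the indicator of an
  interval from 0 to \<open>gen_inv l y\<close>; here that indicator is replaced by its Abel mixing
  density. As \<open>enn2real\<close> sends infinity to 0, finiteness of \<open>gen_inv\<close> at
  positive levels is essential.\<close>

definition abel_density :: "(real \<Rightarrow> real) \<Rightarrow> real \<Rightarrow> ennreal" where
  "abel_density l s = (\<integral>\<^sup>+y\<in>{0<..}. ennreal (abel_ker s (enn2real (gen_inv l y))) \<partial>lborel)"

lemma abel_density_nonpos: "s \<le> 0 \<Longrightarrow> abel_density l s = 0"
  by (simp add: abel_density_def abel_ker_def)

text \<open>Right continuity carries \<open>y < l r\<close> slightly beyond \<open>r\<close>, so the
  superlevel set contains some \<open>(0, c)\<close> with \<open>c > r\<close>. Conversely,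
  \<open>l r \<le> y\<close> and monotonicity confine it to \<open>(0, r)\<close>.\<close>

lemma less_gen_inv_iff:
  assumes [measurable]: "l \<in> borel_measurable borel"
    and mono: "\<And>r s. 0 < r \<Longrightarrow> r \<le> s \<Longrightarrow> l s \<le> l r"
    and cont: "continuous (at_right r) l" and r: "0 < r"
  shows "ennreal r < gen_inv l y \<longleftrightarrow> y < l r"
proof -
  have eq: "gen_inv l y = emeasure lborel {r. 0 < r \<and> y < l r}"
    unfolding gen_inv_def by (rule nn_integral_indicator) measurable
  show ?thesis
  proof
    assume y: "y < l r"
    have "\<forall>\<^sub>F x in at_right r. y < l x"
      using cont y unfolding continuous_within by (rule order_tendstoD(1))
    then obtain b where b: "b > r" "\<And>x. r < x \<Longrightarrow> x < b \<Longrightarrow> y < l x"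
      unfolding eventually_at_right_field by blast
    obtain c where c: "r < c" "c < b" using dense[OF b(1)] by blast
    have "ennreal r < ennreal c" using r c by (simp add: ennreal_less_iff)
    also have "ennreal c = emeasure lborel {0<..<c}" using c r by simp
    also have "\<dots> \<le> gen_inv l y"
      unfolding eq
    proof (rule emeasure_mono)
      show "{0<..<c} \<subseteq> {r. 0 < r \<and> y < l r}"
        using b(2)[of c] c mono[of _ c] by fastforce
    qed measurable
    finally show "ennreal r < gen_inv l y" .
  next
    assume lt: "ennreal r < gen_inv l y"
    show "y < l r"
    proof (rule ccontr)
      assume "\<not> y < l r"
      then have "{r. 0 < r \<and> y < l r} \<subseteq> {0<..<r}"
        using mono[OF r] by (fastforce simp flip: not_le)
      then have "gen_inv l y \<le> emeasure lborel {0<..<r}"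
        unfolding eq by (rule emeasure_mono) simp
      then show False using lt r by simp
    qed
  qed
qed

text \<open>Beyond 1 the weight \<open>min 1 (r^2)\<close> equals 1, so Markov's inequality bounds
  the superlevel set there; the rest has length at most 1.\<close>

lemma gen_inv_finite:
  assumes [measurable]: "l \<in> borel_measurable borel"
    and fin: "(\<integral>\<^sup>+r\<in>{0<..}. ennreal (l r) * ennreal (min 1 (r\<^sup>2)) \<partial>lborel) < \<infinity>" and y: "0 < y"
  shows "gen_inv l y < \<infinity>"
proof -
  let ?A = "{r. 1 < r \<and> y < l r}"
  have "ennreal y * emeasure lborel ?A = (\<integral>\<^sup>+r. ennreal y * indicator ?A r \<partial>lborel)"
    by (rule nn_integral_cmult_indicator[symmetric]) measurable
  also have "\<dots> \<le> (\<integral>\<^sup>+r\<in>{0<..}. ennreal (l r) * ennreal (min 1 (r\<^sup>2)) \<partial>lborel)"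
  proof (rule nn_integral_mono)
    fix r :: real
    have "min 1 (r\<^sup>2) = 1" if "1 < r" using that by (simp add: min_def one_le_power)
    then show "ennreal y * indicator ?A r \<le> ennreal (l r) * ennreal (min 1 (r\<^sup>2)) * indicator {0<..} r"
      by (auto simp: indicator_def intro!: ennreal_leI)
  qed
  also note fin
  finally have A: "emeasure lborel ?A < \<infinity>"
    using y by (auto simp: ennreal_mult_less_top)
  have "gen_inv l y \<le> (\<integral>\<^sup>+r. indicator {0<..1} r + indicator ?A r \<partial>lborel)"
    unfolding gen_inv_def by (intro nn_integral_mono) (auto simp: indicator_def)
  also have "\<dots> = emeasure lborel {0<..1::real} + emeasure lborel ?A"
    by (subst nn_integral_add) auto
  also have "\<dots> < \<infinity>" using A by simp
  finally show ?thesis .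
qed

lemma measurable_gen_inv [measurable (raw)]:
  assumes [measurable]: "(\<lambda>(x, r). l x r) \<in> borel_measurable (M \<Otimes>\<^sub>M borel)" "f \<in> borel_measurable M"
  shows "(\<lambda>x. gen_inv (l x) (f x)) \<in> borel_measurable M"
  unfolding gen_inv_def indicator_def mem_Collect_eq by measurable

lemma measurable_abel_density [measurable (raw)]:
  assumes [measurable]: "(\<lambda>(x, r). l x r) \<in> borel_measurable (M \<Otimes>\<^sub>M borel)" "f \<in> borel_measurable M"
  shows "(\<lambda>x. abel_density (l x) (f x)) \<in> borel_measurable M"
proof -
  have [measurable]: "(\<lambda>p. gen_inv (l (fst p)) (snd p)) \<in> borel_measurable (M \<Otimes>\<^sub>M lborel)"
    by measurable
  show ?thesis unfolding abel_density_def by measurable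
qed

lemma nn_integral_a2_abel_density:
  assumes [measurable]: "l \<in> borel_measurable borel"
    and nonneg: "\<And>r. 0 < r \<Longrightarrow> 0 \<le> l r"
    and mono: "\<And>r s. 0 < r \<Longrightarrow> r \<le> s \<Longrightarrow> l s \<le> l r"
    and cont: "\<And>r. 0 < r \<Longrightarrow> continuous (at_right r) l"
    and fin: "(\<integral>\<^sup>+r\<in>{0<..}. ennreal (l r) * ennreal (min 1 (r\<^sup>2)) \<partial>lborel) < \<infinity>"
    and r: "0 < r"
  shows "(\<integral>\<^sup>+s. ennreal (a2 r s) * abel_density l s \<partial>lborel) = ennreal (l r)"
proof -
  let ?g = "\<lambda>y. enn2real (gen_inv l y)"
  have [measurable]: "?g \<in> borel_measurable borel" by measurable
  have "(\<integral>\<^sup>+s. ennreal (a2 r s) * abel_density l s \<partial>lborel) =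
     (\<integral>\<^sup>+s. \<integral>\<^sup>+y. ennreal (a2 r s) * (ennreal (abel_ker s (?g y)) * indicator {0<..} y) \<partial>lborel \<partial>lborel)"
    unfolding abel_density_def by (simp add: nn_integral_cmult)
  \<comment> \<open>With the level outside, Abel's identity evaluates the inner integral; what
    remains is the length of the set of levels \<open>y\<close> in \<open>(0, l r)\<close>.\<close>
  also have "\<dots> = (\<integral>\<^sup>+y. \<integral>\<^sup>+s. ennreal (a2 r s) * (ennreal (abel_ker s (?g y)) * indicator {0<..} y) \<partial>lborel \<partial>lborel)"
    by (rule lborel_pair.Fubini') measurable
  also have "\<dots> = (\<integral>\<^sup>+y. indicator {0<..<l r} y \<partial>lborel)"
  proof (rule nn_integral_cong)
    fix y
    have "(\<integral>\<^sup>+s. ennreal (a2 r s) * (ennreal (abel_ker s (?g y)) * indicator {0<..} y) \<partial>lborel) =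
       (\<integral>\<^sup>+s. ennreal (a2 r s) * ennreal (abel_ker s (?g y)) \<partial>lborel) * indicator {0<..} y"
      by (subst nn_integral_multc[symmetric]) (auto simp: mult.assoc)
    also have "\<dots> = indicator {r<..} (?g y) * indicator {0<..} y"
      by (simp add: nn_integral_a2_abel_ker[OF r])
    also have "\<dots> = indicator {0<..<l r} y"
    proof (cases "0 < y")
      case True
      have "r < ?g y \<longleftrightarrow> ennreal r < gen_inv l y"
        using gen_inv_finite[OF assms(1) fin True] r
        by (metis ennreal_enn2real ennreal_less_iff infinity_ennreal_def less_imp_le)
      also have "\<dots> \<longleftrightarrow> y < l r" by (rule less_gen_inv_iff) (use assms in auto)
      finally show ?thesis using True by (auto simp: indicator_def)
    qed simp
    finally show "(\<integral>\<^sup>+s. ennreal (a2 r s) * (ennreal (abel_ker s (?g y)) * indicator {0<..} y) \<partial>lborel) =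
      indicator {0<..<l r} y" .
  qed
  also have "\<dots> = ennreal (l r)" using nonneg[OF r] by simp
  finally show ?thesis .
qed

section \<open>Inclusion of the Jurek class in the range\<close>

lemma jurek_subset: "jurek_levy_class \<subseteq> (A_range 2 :: 'a::euclidean_space measure set)"
proof
  fix \<nu> :: "'a measure"
  assume "\<nu> \<in> jurek_levy_class"
  then obtain lam :: "'a measure" and ell :: "'a \<Rightarrow> real \<Rightarrow> real" where
    levy: "levy_measure \<nu>" and
    lam[measurable_cong]: "sets lam = sets borel" and lam0: "emeasure lam (- sphere 0 1) = 0" and
    [measurable]: "(\<lambda>(\<xi>, r). ell \<xi> r) \<in> borel_measurable (borel \<Otimes>\<^sub>M borel)" and
    nonneg: "\<And>\<xi> r. \<xi> \<in> sphere 0 1 \<Longrightarrow> 0 < r \<Longrightarrow> 0 \<le> ell \<xi> r" and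
    mono: "\<And>\<xi> r s. \<xi> \<in> sphere 0 1 \<Longrightarrow> 0 < r \<Longrightarrow> r \<le> s \<Longrightarrow> ell \<xi> s \<le> ell \<xi> r" and
    cont: "\<And>\<xi> r. \<xi> \<in> sphere 0 1 \<Longrightarrow> 0 < r \<Longrightarrow> continuous (at_right r) (ell \<xi>)" and
    eq: "\<And>B. B \<in> sets borel \<Longrightarrow> emeasure \<nu> B =
      (\<integral>\<^sup>+\<xi>\<in>sphere 0 1. (\<integral>\<^sup>+r\<in>{0<..}. ennreal (ell \<xi> r) * indicator B (r *\<^sub>R \<xi>) \<partial>lborel) \<partial>lam)"
    unfolding jurek_levy_class_def mem_Collect_eq by (elim conjE exE) (rule that, (assumption | blast)+)
  have s\<nu>[measurable_cong]: "sets \<nu> = sets borel" using levy by (simp add: levy_measure_def)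
  have ell_meas[measurable]: "ell \<xi> \<in> borel_measurable borel" for \<xi> by measurable
  have ell_meas2: "(\<lambda>(x, r). ell (fst x) r) \<in> borel_measurable ((lam \<Otimes>\<^sub>M borel) \<Otimes>\<^sub>M borel)"
    by measurable
  let ?h = "\<lambda>(\<xi>::'a, r::real). r *\<^sub>R \<xi>"
  \<comment> \<open>\<open>lam\<close> is a measure on the whole space and \<open>ell\<close> is
    controlled only on the unit sphere at positive radii; this weight restricts to that
    region.\<close>
  let ?w = "\<lambda>(\<xi>::'a, r::real). indicator (sphere 0 1) \<xi> * indicator {0<..} r :: ennreal"
  have [measurable]: "sphere (0::'a) 1 \<in> sets borel" by (intro borel_closed closed_sphere)
  have [measurable]: "?w \<in> borel_measurable (lam \<Otimes>\<^sub>M borel)" by measurable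
  have [measurable]: "?h \<in> borel_measurable (lam \<Otimes>\<^sub>M borel)" by measurable
  let ?f = "\<lambda>p. ennreal (ell (fst p) (snd p)) * ?w p"
  have f[measurable]: "?f \<in> borel_measurable (lam \<Otimes>\<^sub>M borel)" by measurable
  have \<nu>: "\<nu> = push lam ?f ?h"
  proof (rule measure_eqI)
    fix B assume "B \<in> sets \<nu>"
    then have [measurable]: "B \<in> sets borel" by (simp add: s\<nu>)
    show "emeasure \<nu> B = emeasure (push lam ?f ?h) B"
      by (subst emeasure_push)
         (auto simp: eq intro!: nn_integral_cong simp: indicator_def)
  qed (simp add: s\<nu>)
  have "(\<integral>\<^sup>+x. ennreal (min 1 (norm x ^ 2)) \<partial>\<nu>) \<noteq> \<infinity>"
    using levy by (auto simp: levy_measure_def)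
  also have "(\<integral>\<^sup>+x. ennreal (min 1 (norm x ^ 2)) \<partial>\<nu>) =
      (\<integral>\<^sup>+\<xi>. \<integral>\<^sup>+r. ?f (\<xi>, r) * ennreal (min 1 (norm (?h (\<xi>, r)) ^ 2)) \<partial>lborel \<partial>lam)"
    unfolding \<nu> by (rule nn_integral_push) measurable
  \<comment> \<open>Radial integrability is available only for almost every direction. This
    suffices, because the identity to be proved is integrated against \<open>lam\<close>.\<close>
  finally have "AE \<xi> in lam. (\<integral>\<^sup>+r. ?f (\<xi>, r) * ennreal (min 1 (norm (?h (\<xi>, r)) ^ 2)) \<partial>lborel) \<noteq> \<infinity>"
    by (rule nn_integral_PInf_AE[rotated]) measurable
  then have fin: "AE \<xi> in lam. \<xi> \<in> sphere 0 1 \<longrightarrow>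
      (\<integral>\<^sup>+r\<in>{0<..}. ennreal (ell \<xi> r) * ennreal (min 1 (r\<^sup>2)) \<partial>lborel) < \<infinity>"
  proof eventually_elim
    case (elim \<xi>)
    show ?case
    proof
      assume \<xi>: "\<xi> \<in> sphere 0 1"
      have "(\<integral>\<^sup>+r. ?f (\<xi>, r) * ennreal (min 1 (norm (?h (\<xi>, r)) ^ 2)) \<partial>lborel) = 
        (\<integral>\<^sup>+r\<in>{0<..}. ennreal (ell \<xi> r) * ennreal (min 1 (r\<^sup>2)) \<partial>lborel)"
        using \<xi> by (auto intro!: nn_integral_cong simp: indicator_def)
      then show "(\<integral>\<^sup>+r\<in>{0<..}. ennreal (ell \<xi> r) * ennreal (min 1 (r\<^sup>2)) \<partial>lborel) < \<infinity>"
        using elim by (simp add: top.not_eq_extremum)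
    qed
  qed
  let ?k = "\<lambda>p. abel_density (ell (fst p)) (snd p) * ?w p"
  have [measurable]: "(\<lambda>p. abel_density (ell (fst p)) (snd p)) \<in> borel_measurable (lam \<Otimes>\<^sub>M borel)"
    by (rule measurable_abel_density[OF ell_meas2]) measurable
  have k[measurable]: "?k \<in> borel_measurable (lam \<Otimes>\<^sub>M borel)" by measurable
  \<comment> \<open>The preimage keeps the spherical measure and replaces each radial density by its
    Abel mixing density.\<close>
  define \<eta> where "\<eta> = push lam ?k ?h"
  have s\<eta>: "sets \<eta> = sets borel" by (simp add: \<eta>_def)
  have \<eta>0: "emeasure \<eta> {0} = 0"
  proof -
    have "emeasure \<eta> {0} = (\<integral>\<^sup>+\<xi>. \<integral>\<^sup>+r. ?k (\<xi>, r) * indicator {0} (?h (\<xi>, r)) \<partial>lborel \<partial>lam)"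
      unfolding \<eta>_def by (rule emeasure_push) measurable
    also have "\<dots> = (\<integral>\<^sup>+\<xi>. \<integral>\<^sup>+r. 0 \<partial>(lborel :: real measure) \<partial>lam)"
      by (intro nn_integral_cong) (auto simp: indicator_def)
    finally show ?thesis by simp
  qed
  have A: "A_op 2 \<eta> = \<nu>"
  proof (rule measure_eqI)
    fix B assume "B \<in> sets (A_op 2 \<eta>)"
    then have [measurable]: "B \<in> sets borel" by simp
    define G where "G x = (\<integral>\<^sup>+r\<in>{0<..}. ennreal (akern 2 r (norm x)) * indicator B (r *\<^sub>R (x /\<^sub>R norm x)) \<partial>lborel)
      * indicator (-{0}) x" for x :: 'a
    have G[measurable]: "G \<in> borel_measurable borel" unfolding G_def by measurable
    have "emeasure (A_op 2 \<eta>) B = (\<integral>\<^sup>+x. G x \<partial>\<eta>)"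
      by (simp add: emeasure_A_op[OF s\<eta>] G_def)
    also have "\<dots> = (\<integral>\<^sup>+\<xi>. \<integral>\<^sup>+s. ?k (\<xi>, s) * G (?h (\<xi>, s)) \<partial>lborel \<partial>lam)"
      unfolding \<eta>_def by (rule nn_integral_push) measurable
    also have "\<dots> = (\<integral>\<^sup>+\<xi>\<in>sphere 0 1. (\<integral>\<^sup>+r\<in>{0<..}. ennreal (ell \<xi> r) * indicator B (r *\<^sub>R \<xi>) \<partial>lborel) \<partial>lam)"
    proof (rule nn_integral_cong_AE, rule AE_mp[OF fin], intro AE_I2 impI)
      fix \<xi> :: 'a
      assume fin: "\<xi> \<in> sphere 0 1 \<longrightarrow>
        (\<integral>\<^sup>+r\<in>{0<..}. ennreal (ell \<xi> r) * ennreal (min 1 (r\<^sup>2)) \<partial>lborel) < \<infinity>"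
      show "(\<integral>\<^sup>+s. ?k (\<xi>, s) * G (?h (\<xi>, s)) \<partial>lborel) =
        (\<integral>\<^sup>+r\<in>{0<..}. ennreal (ell \<xi> r) * indicator B (r *\<^sub>R \<xi>) \<partial>lborel) * indicator (sphere 0 1) \<xi>"
      proof (cases "\<xi> \<in> sphere 0 1")
        case True
        let ?d = "abel_density (ell \<xi>)"
        have [measurable]: "?d \<in> borel_measurable borel" by measurable
        have "?k (\<xi>, s) * G (?h (\<xi>, s)) =
          (\<integral>\<^sup>+r. ?d s * (ennreal (a2 r s) * (indicator B (r *\<^sub>R \<xi>) * indicator {0<..} r)) \<partial>lborel)" for s
        proof (cases "0 < s")
          case s: True
          then have "s *\<^sub>R \<xi> \<noteq> 0" using True by auto
          with s have "G (?h (\<xi>, s)) = (\<integral>\<^sup>+r. ennreal (a2 r s) * (indicator B (r *\<^sub>R \<xi>) * indicator {0<..} r) \<partial>lborel)"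
            using True by (auto simp: G_def akern_def mult.assoc)
          then show ?thesis using s True by (simp add: nn_integral_cmult)
        qed (use True in \<open>simp add: abel_density_nonpos\<close>)
        then have "(\<integral>\<^sup>+s. ?k (\<xi>, s) * G (?h (\<xi>, s)) \<partial>lborel) =
          (\<integral>\<^sup>+s. \<integral>\<^sup>+r. ?d s * (ennreal (a2 r s) * (indicator B (r *\<^sub>R \<xi>) * indicator {0<..} r)) \<partial>lborel \<partial>lborel)"
          by simp
        \<comment> \<open>Exchanging radius and scale makes the inner integral the arcsine mixture,
          which reproduces \<open>ell \<xi> r\<close>.\<close>
        also have "\<dots> = (\<integral>\<^sup>+r. \<integral>\<^sup>+s. ?d s * (ennreal (a2 r s) * (indicator B (r *\<^sub>R \<xi>) * indicator {0<..} r)) \<partial>lborel \<partial>lborel)"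
          by (rule lborel_pair.Fubini') measurable
        also have "\<dots> = (\<integral>\<^sup>+r\<in>{0<..}. ennreal (ell \<xi> r) * indicator B (r *\<^sub>R \<xi>) \<partial>lborel)"
        proof (rule nn_integral_cong)
          fix r :: real
          have "(\<integral>\<^sup>+s. ?d s * (ennreal (a2 r s) * (indicator B (r *\<^sub>R \<xi>) * indicator {0<..} r)) \<partial>lborel) =
            (\<integral>\<^sup>+s. ennreal (a2 r s) * ?d s \<partial>lborel) * (indicator B (r *\<^sub>R \<xi>) * indicator {0<..} r)"
            by (subst nn_integral_multc[symmetric]) (auto simp: mult_ac)
          also have "\<dots> = ennreal (ell \<xi> r) * indicator B (r *\<^sub>R \<xi>) * indicator {0<..} r"
          proof (cases "0 < r")
            case r: True
            have "(\<integral>\<^sup>+s. ennreal (a2 r s) * ?d s \<partial>lborel) = ennreal (ell \<xi> r)"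
              using True fin r nonneg mono cont
              by (intro nn_integral_a2_abel_density) auto
            then show ?thesis by (simp add: mult.assoc)
          qed simp
          finally show "(\<integral>\<^sup>+s. ?d s * (ennreal (a2 r s) * (indicator B (r *\<^sub>R \<xi>) * indicator {0<..} r)) \<partial>lborel) =
            ennreal (ell \<xi> r) * indicator B (r *\<^sub>R \<xi>) * indicator {0<..} r" .
        qed
        finally show ?thesis using True by simp
      qed simp
    qed
    also have "\<dots> = emeasure \<nu> B" by (simp add: eq)
    finally show "emeasure (A_op 2 \<eta>) B = emeasure \<nu> B" .
  qed (simp add: s\<nu>)
  \<comment> \<open>Integrability of \<open>\<eta>\<close> is not computed from its density but
    inherited from its image \<open>\<nu>\<close>.\<close>
  have "levy_measure \<eta>"
    by (rule levy_measure_if_A_op[OF s\<eta> \<eta>0]) (simp add: A levy)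
  then show "\<nu> \<in> A_range 2"
    using A by (auto simp: A_range_def levy_class_def intro!: image_eqI[where x=\<eta>])
qed

section \<open>Strictness: the image of a point mass\<close>

lemma A_range_not_jurek: "\<exists>\<mu>. \<mu> \<in> A_range 2 \<and> \<mu> \<notin> (jurek_levy_class :: 'a::euclidean_space measure set)"
proof -
  obtain e :: 'a where "e \<in> Basis" using nonempty_Basis by blast
  then have e: "norm e = 1" by simp
  \<comment> \<open>The Dirac measure at a unit vector; its image is the arcsine law on the ray
    through \<open>e\<close>.\<close>
  define \<delta> where "\<delta> = distr (count_space {()}) borel (\<lambda>_. e)"
  have \<delta>: "sets \<delta> = sets borel" "\<And>F. F \<in> borel_measurable borel \<Longrightarrow> (\<integral>\<^sup>+x. F x \<partial>\<delta>) = F e" "emeasure \<delta> {0} = 0"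
    using e by (auto simp: \<delta>_def nn_integral_distr nn_integral_count_space_finite emeasure_distr)
  define \<mu> where "\<mu> = A_op 2 \<delta>"
  have e0: "e \<noteq> 0" using e by auto
  have "(\<integral>\<^sup>+x. ennreal (min 1 (norm x ^ 2)) \<partial>\<delta>) < \<infinity>"
    by (subst \<delta>) auto
  then have "levy_measure \<delta>"
    by (auto simp: levy_measure_def \<delta>)
  then have in_range: "\<mu> \<in> A_range 2"
    by (auto simp: A_range_def levy_class_def \<mu>_def)
  \<comment> \<open>Testing on segments of this ray extracts the radial density without any
    uniqueness result for polar decompositions.\<close>
  define seg where "seg a b = (\<lambda>r. r *\<^sub>R e) ` {a..b}" for a b :: real
  have seg_meas[measurable]: "seg a b \<in> sets borel" for a b
    unfolding seg_def
    by (intro borel_closed compact_imp_closed compact_continuous_image continuous_intros compact_Icc)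
  have seg_e: "r *\<^sub>R e \<in> seg a b \<longleftrightarrow> a \<le> r \<and> r \<le> b" for r a b
    using e0 by (auto simp: seg_def)
  have \<mu>_seg: "emeasure \<mu> (seg a b) = (\<integral>\<^sup>+r. ennreal (a2 r 1) * indicator {a..b} r \<partial>lborel)" if "0 < a" for a b
  proof -
    have "emeasure \<mu> (seg a b) = (\<integral>\<^sup>+x\<in>- {0}. (\<integral>\<^sup>+r\<in>{0<..}. ennreal (akern 2 r (norm x)) *
        indicator (seg a b) (r *\<^sub>R (x /\<^sub>R norm x)) \<partial>lborel) \<partial>\<delta>)"
      unfolding \<mu>_def by (rule emeasure_A_op) (auto simp: \<delta>)
    also have "\<dots> = (\<integral>\<^sup>+r\<in>{0<..}. ennreal (a2 r 1) * indicator (seg a b) (r *\<^sub>R e) \<partial>lborel)"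
      by (subst \<delta>) (auto simp: e e0 akern_def)
    also have "\<dots> = (\<integral>\<^sup>+r. ennreal (a2 r 1) * indicator {a..b} r \<partial>lborel)"
      using that by (intro nn_integral_cong) (auto simp: indicator_def seg_e)
    finally show ?thesis .
  qed
  have "\<mu> \<notin> jurek_levy_class"
  proof
    assume "\<mu> \<in> jurek_levy_class"
    then obtain lam :: "'a measure" and ell :: "'a \<Rightarrow> real \<Rightarrow> real" where
      lam[measurable_cong]: "sets lam = sets borel" and
      [measurable]: "(\<lambda>(\<xi>, r). ell \<xi> r) \<in> borel_measurable (borel \<Otimes>\<^sub>M borel)" and
      mono: "\<And>\<xi> r s. \<xi> \<in> sphere 0 1 \<Longrightarrow> 0 < r \<Longrightarrow> r \<le> s \<Longrightarrow> ell \<xi> s \<le> ell \<xi> r" and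
      eq: "\<And>B. B \<in> sets borel \<Longrightarrow> emeasure \<mu> B =
        (\<integral>\<^sup>+\<xi>\<in>sphere 0 1. (\<integral>\<^sup>+r\<in>{0<..}. ennreal (ell \<xi> r) * indicator B (r *\<^sub>R \<xi>) \<partial>lborel) \<partial>lam)"
      unfolding jurek_levy_class_def mem_Collect_eq by (elim conjE exE) (rule that, (assumption | blast)+)
    have [measurable]: "ell e \<in> borel_measurable borel" by measurable
    \<comment> \<open>Distinct rays meet only at the origin, so for \<open>a > 0\<close> the
      direction \<open>e\<close> alone contributes. The mass of \<open>{e}\<close> under
      \<open>lam\<close> stays a factor and is never divided by, so it may be 0 or infinite.\<close>
    have on_ray: "emeasure \<mu> (seg a b) =
        (\<integral>\<^sup>+r. ennreal (ell e r) * indicator {a..b} r \<partial>lborel) * emeasure lam {e}" if "0 < a" for a b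
    proof -
      have "emeasure \<mu> (seg a b) = (\<integral>\<^sup>+\<xi>. (\<integral>\<^sup>+r. ennreal (ell e r) * indicator {a..b} r \<partial>lborel) * indicator {e} \<xi> \<partial>lam)"
        unfolding eq[OF seg_meas]
      proof (rule nn_integral_cong)
        fix \<xi> :: 'a
        show "(\<integral>\<^sup>+r\<in>{0<..}. ennreal (ell \<xi> r) * indicator (seg a b) (r *\<^sub>R \<xi>) \<partial>lborel) * indicator (sphere 0 1) \<xi> =
          (\<integral>\<^sup>+r. ennreal (ell e r) * indicator {a..b} r \<partial>lborel) * indicator {e} \<xi>"
        proof (cases "\<xi> = e")
          case True
          then show ?thesis using e that
            by (auto intro!: nn_integral_cong simp: indicator_def seg_e)
        next
          case False
          have "r *\<^sub>R \<xi> \<notin> seg a b" if "norm \<xi> = 1" "0 < r" for r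
          proof
            assume "r *\<^sub>R \<xi> \<in> seg a b"
            then obtain q where q: "r *\<^sub>R \<xi> = q *\<^sub>R e" "a \<le> q" unfolding seg_def by fastforce
            from q(1) have "norm (r *\<^sub>R \<xi>) = norm (q *\<^sub>R e)" by (rule arg_cong)
            then have "r = q" unfolding norm_scaleR using that e q(2) \<open>0 < a\<close> by simp
            then show False using q that False by simp
          qed
          then have "(\<integral>\<^sup>+r\<in>{0<..}. ennreal (ell \<xi> r) * indicator (seg a b) (r *\<^sub>R \<xi>) \<partial>lborel) =
            (\<integral>\<^sup>+r. 0 \<partial>(lborel :: real measure))" if "norm \<xi> = 1"
            using that by (intro nn_integral_cong) (auto simp: indicator_def)
          then show ?thesis using False by (cases "norm \<xi> = 1") simp_all
        qed
      qed
      also have "\<dots> = (\<integral>\<^sup>+r. ennreal (ell e r) * indicator {a..b} r \<partial>lborel) * emeasure lam {e}"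
        by (rule nn_integral_cmult_indicator) (simp add: lam)
      finally show ?thesis .
    qed
    have const: "(\<integral>\<^sup>+r. ennreal c * indicator {a..b} r \<partial>lborel) = ennreal c * ennreal (b - a)" if "a \<le> b" for a b c :: real
      using that by (subst nn_integral_cmult_indicator) auto
    \<comment> \<open>The disjoint intervals \<open>[1/2, 7/12]\<close> and
      \<open>[2/3, 3/4]\<close> have equal length 1/12. A nonincreasing \<open>ell e\<close> gives
      the right one no more mass than the left one, whereas \<open>a2\<close> increases; the gap
      from 7/12 to 2/3 makes the contradiction strict.\<close>
    have "ennreal (a2 (2/3) 1) * ennreal (3/4 - 2/3) =
        (\<integral>\<^sup>+r. ennreal (a2 (2/3) 1) * indicator {2/3..3/4::real} r \<partial>lborel)"
      by (rule const[symmetric]) simp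
    also have "\<dots> \<le> (\<integral>\<^sup>+r. ennreal (a2 r 1) * indicator {2/3..3/4::real} r \<partial>lborel)"
      by (intro nn_integral_mono) (auto simp: indicator_def intro!: ennreal_leI a2_mono)
    also have "\<dots> = (\<integral>\<^sup>+r. ennreal (ell e r) * indicator {2/3..3/4::real} r \<partial>lborel) * emeasure lam {e}"
      by (simp flip: on_ray \<mu>_seg)
    also have "\<dots> \<le> (\<integral>\<^sup>+r. ennreal (ell e (7/12)) * indicator {2/3..3/4::real} r \<partial>lborel) * emeasure lam {e}"
      by (rule mult_right_mono, rule nn_integral_mono) (use e in \<open>auto simp: indicator_def intro!: ennreal_leI mono\<close>)
    also have "\<dots> = (\<integral>\<^sup>+r. ennreal (ell e (7/12)) * indicator {1/2..7/12::real} r \<partial>lborel) * emeasure lam {e}"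
      by (subst (1 2) const) auto
    also have "\<dots> \<le> (\<integral>\<^sup>+r. ennreal (ell e r) * indicator {1/2..7/12::real} r \<partial>lborel) * emeasure lam {e}"
      by (rule mult_right_mono, rule nn_integral_mono) (use e in \<open>auto simp: indicator_def intro!: ennreal_leI mono\<close>)
    also have "\<dots> = (\<integral>\<^sup>+r. ennreal (a2 r 1) * indicator {1/2..7/12::real} r \<partial>lborel)"
      by (simp flip: on_ray \<mu>_seg)
    also have "\<dots> \<le> (\<integral>\<^sup>+r. ennreal (a2 (7/12) 1) * indicator {1/2..7/12::real} r \<partial>lborel)"
      by (intro nn_integral_mono) (auto simp: indicator_def intro!: ennreal_leI a2_mono)
    also have "\<dots> = ennreal (a2 (7/12) 1) * ennreal (7/12 - 1/2)"
      by (rule const) simp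
    finally have "a2 (2/3) 1 \<le> a2 (7/12) 1"
      by (simp add: a2_nonneg flip: ennreal_mult)
    moreover have "a2 (7/12) 1 < a2 (2/3) 1"
      by (rule a2_strict_mono) auto
    ultimately show False by simp
  qed
  with in_range show ?thesis by blast
qed

theorem theorem2p12:
  shows "jurek_levy_class \<subset> (A_range 1 :: 'a::euclidean_space measure set)
         \<and> A_range 1 = (A_range 2 :: 'a measure set)"
  using A_range_1_eq_2 jurek_subset A_range_not_jurek by blast

end
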